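(* Let $L=\langle a,t \mid a^2,\ [t^{i}at^{-i},t^{j}at^{-j}],\ i,j\in\mathbb{Z}\rangle$ be the lamplighter group, and let $|\cdot|$ denote word length with respect to the generating set $\{t,ta\}$. For every integer $k\ge1$ there is an element $w_k\in L$ satisfying the following conditions. (1) $|w_kg^{\pm1}|=|w_k|-1$ for all $g\in\{t,ta\}$ and both signs. (2) $|w_kg_1g_2\cdots g_l|=|w_k|-l$ for all integers $l\in[1,k]$ and all $g_1,\dots,g_l\in\{t,ta\}$; furthermore, $|w_kg_1g_2\cdots g_lh|=|w_k|-l+1$ for all integers $l\in[1,k-1]$, all $g_1,\dots,g_l\in\{t,ta\}$ and all $h\in\{t^{-1},at^{-1}\}$. (3) $|w_kh_1h_2\cdots h_l|=|w_k|-l$ for all integers $l\in[1,k]$ and all $h_1,\dots,h_l\in\{t^{-1},at^{-1}\}$; furthermore, $|w_kh_1h_2\cdots h_lg|=|w_k|-l+1$ for all integers $l\in[1,k-1]$, all $h_1,\dots,h_l\in\{t^{-1},at^{-1}\}$ and all $g\in\{t,ta\}$.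
   Context: The word length of $w$ with respect to $\{t,ta\}$ is the least $n$ such that $w$ is a product of $n$ elements of $\{t,ta,t^{-1},(ta)^{-1}\}$; note that $(ta)^{-1}=at^{-1}$ because $a^2=1$. The paper calls elements satisfying these conditions "seesaw-like". *)

theory Defs
  imports "HOL-Algebra.Group"
begin

(* A letter (x, True) stands for the generator x, and (x, False) for its formal inverse. *)
type_synonym 'x gword = "('x \<times> bool) list"

definition word_inv :: "'x gword \<Rightarrow> 'x gword" where
  "word_inv u = rev (map (\<lambda>(x, b). (x, \<not> b)) u)"

(* The convention is [u, v] = u v u^-1 v^-1. *)
definition word_commutator :: "'x gword \<Rightarrow> 'x gword \<Rightarrow> 'x gword" where
  "word_commutator u v = u @ v @ word_inv u @ word_inv v"

definition letter_power :: "'x \<Rightarrow> int \<Rightarrow> 'x gword" where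
  "letter_power x i = replicate (nat \<bar>i\<bar>) (x, 0 \<le> i)"

(* The least congruence on words under which inverse letters cancel and the relators in R
   become trivial: u and v are related iff they represent the same element of the free group
   modulo the normal closure of R. *)
inductive pres_eq :: "'x gword set \<Rightarrow> 'x gword \<Rightarrow> 'x gword \<Rightarrow> bool"
  for R :: "'x gword set" where
  refl: "pres_eq R u u"
| sym: "pres_eq R u v \<Longrightarrow> pres_eq R v u"
| trans: "pres_eq R u v \<Longrightarrow> pres_eq R v w \<Longrightarrow> pres_eq R u w"
| cancel: "pres_eq R (u @ [(x, b), (x, \<not> b)] @ v) (u @ v)"
| relator: "r \<in> R \<Longrightarrow> pres_eq R (u @ r @ v) (u @ v)"

definition pres_rel :: "'x gword set \<Rightarrow> ('x gword \<times> 'x gword) set" where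
  "pres_rel R = {(u, v). pres_eq R u v}"

definition pres_class :: "'x gword set \<Rightarrow> 'x gword \<Rightarrow> 'x gword set" where
  "pres_class R u = pres_rel R `` {u}"

(* The group with all elements of type 'x as generators and R as relators. *)
definition presented_group :: "'x gword set \<Rightarrow> 'x gword set monoid" where
  "presented_group R =
     \<lparr>carrier = UNIV // pres_rel R,
      mult = (\<lambda>A B. \<Union>u\<in>A. \<Union>v\<in>B. pres_class R (u @ v)),
      one = pres_class R []\<rparr>"

(* Word length of x in G with respect to S; the LEAST is unspecified unless x lies in the
   subgroup generated by S. *)
definition word_length :: "('a, 'b) monoid_scheme \<Rightarrow> 'a set \<Rightarrow> 'a \<Rightarrow> nat" where
  "word_length G S x =
     (LEAST n. \<exists>xs. length xs = n \<and> set xs \<subseteq> S \<union> m_inv G ` S \<and>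
        foldr (mult G) xs (one G) = x)"

datatype lamp_gen = Gen_a | Gen_t

(* The word t^i a t^-i. *)
definition lamp_conj :: "int \<Rightarrow> lamp_gen gword" where
  "lamp_conj i = letter_power Gen_t i @ [(Gen_a, True)] @ letter_power Gen_t (- i)"

definition lamplighter_relators :: "lamp_gen gword set" where
  "lamplighter_relators =
     {letter_power Gen_a 2} \<union> {word_commutator (lamp_conj i) (lamp_conj j) | i j. True}"

definition lamplighter :: "lamp_gen gword set monoid" where
  "lamplighter = presented_group lamplighter_relators"

definition lamp_a :: "lamp_gen gword set" where
  "lamp_a = pres_class lamplighter_relators [(Gen_a, True)]"

definition lamp_t :: "lamp_gen gword set" where
  "lamp_t = pres_class lamplighter_relators [(Gen_t, True)]"

lemma equiv_pres_rel: "equiv UNIV (pres_rel R)"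
  unfolding equiv_def refl_on_def sym_def trans_def pres_rel_def
  by (simp add: pres_eq.refl) (meson pres_eq.sym pres_eq.trans)

lemma pres_eq_append_left: "pres_eq R u v \<Longrightarrow> pres_eq R (w @ u) (w @ v)"
proof (induction rule: pres_eq.induct)
  case (cancel u x b v)
  show ?case using pres_eq.cancel[of R "w @ u" x b v] by simp
next
  case (relator r u v)
  then show ?case using pres_eq.relator[of r R "w @ u" v] by simp
qed (blast intro: pres_eq.refl pres_eq.sym pres_eq.trans)+

lemma pres_eq_append_right: "pres_eq R u v \<Longrightarrow> pres_eq R (u @ w) (v @ w)"
proof (induction rule: pres_eq.induct)
  case (cancel u x b v)
  show ?case using pres_eq.cancel[of R u x b "v @ w"] by simp
next
  case (relator r u v)
  then show ?case using pres_eq.relator[of r R u "v @ w"] by simp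
qed (blast intro: pres_eq.refl pres_eq.sym pres_eq.trans)+

lemma pres_eq_append:
  "pres_eq R u u' \<Longrightarrow> pres_eq R v v' \<Longrightarrow> pres_eq R (u @ v) (u' @ v')"
  by (meson pres_eq.trans pres_eq_append_left pres_eq_append_right)

lemma pres_class_eq_iff: "pres_class R u = pres_class R v \<longleftrightarrow> pres_eq R u v"
  unfolding pres_class_def
  using eq_equiv_class_iff[OF equiv_pres_rel, of u v R] by (simp add: pres_rel_def)

lemma carrier_presented_group: "carrier (presented_group R) = range (pres_class R)"
  by (auto simp: presented_group_def quotient_def pres_class_def)

lemma one_presented_group: "\<one>\<^bsub>presented_group R\<^esub> = pres_class R []"
  by (simp add: presented_group_def)

lemma mult_presented_group:
  "pres_class R u \<otimes>\<^bsub>presented_group R\<^esub> pres_class R v = pres_class R (u @ v)"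
proof -
  have mem: "x \<in> pres_class R y \<longleftrightarrow> pres_eq R y x" for x y
    by (simp add: pres_class_def pres_rel_def)
  have "pres_class R (u' @ v') = pres_class R (u @ v)"
    if "u' \<in> pres_class R u" "v' \<in> pres_class R v" for u' v'
    using that by (simp add: mem pres_class_eq_iff pres_eq.sym pres_eq_append)
  moreover have "u \<in> pres_class R u" "v \<in> pres_class R v"
    by (simp_all add: mem pres_eq.refl)
  ultimately have "(\<Union>u'\<in>pres_class R u. \<Union>v'\<in>pres_class R v. pres_class R (u' @ v'))
      = pres_class R (u @ v)"
    by blast
  then show ?thesis by (simp add: presented_group_def)
qed

lemma pres_eq_word_inv_left: "pres_eq R (word_inv u @ u) []"
proof (induction u)
  case Nil
  show ?case by (simp add: word_inv_def pres_eq.refl)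
next
  case (Cons y u)
  obtain x b where y: "y = (x, b)" by fastforce
  have "pres_eq R (word_inv (y # u) @ y # u) (word_inv u @ u)"
    using pres_eq.cancel[of R "word_inv u" x "\<not> b" u] by (simp add: word_inv_def y)
  then show ?case using Cons.IH pres_eq.trans by blast
qed

lemma group_presented_group: "group (presented_group R)"
proof (rule groupI)
  fix A assume "A \<in> carrier (presented_group R)"
  then obtain u where u: "A = pres_class R u" by (auto simp: carrier_presented_group)
  have "pres_class R (word_inv u) \<otimes>\<^bsub>presented_group R\<^esub> A = \<one>\<^bsub>presented_group R\<^esub>"
    by (simp add: u mult_presented_group one_presented_group pres_class_eq_iff
        pres_eq_word_inv_left)
  then show "\<exists>B\<in>carrier (presented_group R).
      B \<otimes>\<^bsub>presented_group R\<^esub> A = \<one>\<^bsub>presented_group R\<^esub>"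
    by (auto simp: carrier_presented_group)
qed (auto simp: carrier_presented_group one_presented_group mult_presented_group)

lemma group_lamplighter: "group lamplighter"
  by (simp add: lamplighter_def group_presented_group)

end

theory Submission
  imports Defs
begin

text \<open>
  An element of the lamplighter group is a finite set of lit lamps together with a position.
  Right multiplication by a generator moves across an edge of the integer line and may toggle the
  lamp at its right endpoint. Regarding this lamp as a lamp on the edge, the two choices of
  generator leave an arbitrary state on the edge being crossed. Hence the length of (f, p) is the
  length of a shortest path from 0 to p that crosses every lit edge; if these edges and p span
  the interval from -m to M, it equals 2(M + m) - |p|.

  The element w with lamps k and 1 - k lit and position 0 has length 4k. The first k steps in one
  direction cannot change the interval that has to be covered: either its endpoint edge is still
  lit, or the position has reached that endpoint. So the length is 4k - |p| along all these paths.
\<close>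

section \<open>Words acting on lamp configurations\<close>

type_synonym lamp_state = "(int \<Rightarrow> bool) \<times> int"

text \<open>The sign of a \<open>Gen_a\<close> letter is ignored because toggling a lamp is its own
  inverse.\<close>

fun lamp_step :: "lamp_gen \<times> bool \<Rightarrow> lamp_state \<Rightarrow> lamp_state" where
  "lamp_step (Gen_a, b) (f, p) = (f(p := \<not> f p), p)"
| "lamp_step (Gen_t, b) (f, p) = (f, if b then p + 1 else p - 1)"

text \<open>Words act on the right, so the first letter acts first.\<close>

abbreviation lamp_run :: "lamp_gen gword \<Rightarrow> lamp_state \<Rightarrow> lamp_state" where
  "lamp_run \<equiv> fold lamp_step"

abbreviation lamp_start :: lamp_state where
  "lamp_start \<equiv> (\<lambda>_. False, 0)"

abbreviation lamp_word_eq :: "lamp_gen gword \<Rightarrow> lamp_gen gword \<Rightarrow> bool" (infix \<open>\<approx>\<close> 50) where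
  "u \<approx> v \<equiv> pres_eq lamplighter_relators u v"

declare pres_eq.trans [trans]

lemma lamp_step_cancel: "lamp_step (x, \<not> b) (lamp_step (x, b) s) = s"
  by (cases x; cases s) auto

lemma lamp_run_word_inv: "lamp_run (word_inv u) (lamp_run u s) = s"
proof (induction u arbitrary: s)
  case (Cons y u)
  then show ?case
    by (cases y) (simp add: word_inv_def lamp_step_cancel)
qed (simp add: word_inv_def)

lemma word_inv_word_inv: "word_inv (word_inv u) = u"
  by (induction u) (auto simp: word_inv_def)

lemma lamp_run_letter_power_t: "lamp_run (letter_power Gen_t i) (f, p) = (f, p + i)"
proof -
  have "lamp_run (replicate n (Gen_t, b)) (f, p) = (f, if b then p + int n else p - int n)" for n b
    by (induction n arbitrary: p) auto
  then show ?thesis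
    by (auto simp: letter_power_def)
qed

lemma lamp_run_lamp_conj:
  "lamp_run (lamp_conj i) (f, p) = (f(p + i := \<not> f (p + i)), p)"
  by (simp add: lamp_conj_def lamp_run_letter_power_t)

text \<open>Two toggles in place cancel. Each \<open>lamp_conj i\<close> toggles a single lamp and
  returns to its position, and such toggles commute, so every commutator relator acts
  trivially.\<close>

lemma lamp_run_relator:
  assumes "r \<in> lamplighter_relators"
  shows "lamp_run r s = s"
proof -
  obtain f p where s: "s = (f, p)" by fastforce
  consider "r = letter_power Gen_a 2" | i j where "r = word_commutator (lamp_conj i) (lamp_conj j)"
    using assms by (auto simp: lamplighter_relators_def)
  then show ?thesis
  proof cases
    case 1
    then show ?thesis by (simp add: s letter_power_def numeral_2_eq_2)
  next
    case (2 i j)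
    have "lamp_run (lamp_conj j) (lamp_run (lamp_conj i) s)
        = lamp_run (lamp_conj i) (lamp_run (lamp_conj j) s)"
      by (auto simp: s lamp_run_lamp_conj fun_eq_iff)
    then show ?thesis
      by (simp add: 2 word_commutator_def lamp_run_word_inv)
  qed
qed

lemma lamp_run_pres_eq: "u \<approx> v \<Longrightarrow> lamp_run u s = lamp_run v s"
  by (induction arbitrary: s rule: pres_eq.induct)
    (auto simp: lamp_step_cancel[simplified] lamp_run_relator simp del: split_paired_All)

section \<open>Word calculus and a normal form in the presentation\<close>

lemma pres_eq_in_context: "pres_eq R u v \<Longrightarrow> pres_eq R (x @ u @ y) (x @ v @ y)"
  by (simp add: pres_eq_append_left pres_eq_append_right)

lemma pres_eq_word_inv_right: "pres_eq R (u @ word_inv u) []"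
  using pres_eq_word_inv_left[of R "word_inv u"] by (simp add: word_inv_word_inv)

lemma letter_power_uminus: "letter_power x (- i) = word_inv (letter_power x i)"
  by (cases "i = 0") (auto simp: letter_power_def word_inv_def)

text \<open>Treats steps away from 0 in both directions at once. Exponent 0 counts as nonnegative in
  \<open>letter_power\<close>, so \<open>i = 0\<close> is listed separately to let an inverse letter
  come first.\<close>

lemma letter_power_extend:
  assumes "nat \<bar>j\<bar> = Suc (nat \<bar>i\<bar>)" and "(0 \<le> j) = b" and "i = 0 \<or> (0 \<le> i) = b"
  shows "letter_power x j = letter_power x i @ [(x, b)]"
proof -
  have "letter_power x j = replicate (nat \<bar>i\<bar>) (x, b) @ [(x, b)]"
    unfolding letter_power_def assms(1,2) by (simp add: replicate_append_same)
  moreover have "letter_power x i = replicate (nat \<bar>i\<bar>) (x, b)"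
    using assms(3) unfolding letter_power_def by (elim disjE) simp_all
  ultimately show ?thesis by simp
qed

text \<open>Away from 0 the two words coincide; towards 0 the new letter cancels the last letter of
  \<open>letter_power x i\<close>.\<close>

lemma letter_power_snoc:
  "pres_eq R (letter_power x i @ [(x, b)]) (letter_power x (if b then i + 1 else i - 1))"
proof (cases "if b then i \<ge> 0 else i \<le> 0")
  case True
  then have "letter_power x (if b then i + 1 else i - 1) = letter_power x i @ [(x, b)]"
    by (intro letter_power_extend) (auto split: if_splits)
  then show ?thesis by (simp add: pres_eq.refl)
next
  case False
  define j where "j = (if b then i + 1 else i - 1)"
  have "letter_power x i = letter_power x j @ [(x, \<not> b)]"
    using False by (intro letter_power_extend) (auto simp: j_def split: if_splits)
  then show ?thesis
    using pres_eq.cancel[of R "letter_power x j" x "\<not> b" "[]"] by (simp add: j_def)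
qed

lemma lamp_a_square: "[(Gen_a, True), (Gen_a, True)] \<approx> []"
  using pres_eq.relator[of "letter_power Gen_a 2" lamplighter_relators "[]" "[]"]
  by (simp add: lamplighter_relators_def letter_power_def numeral_2_eq_2)

text \<open>For the formal inverse, append the trivial word \<open>a a\<close> and cancel.\<close>

lemma lamp_a_involution: "[(Gen_a, b)] \<approx> [(Gen_a, True)]"
proof (cases b)
  case False
  have "[(Gen_a, False)] \<approx> [(Gen_a, False), (Gen_a, True), (Gen_a, True)]"
    using pres_eq_append_left[OF lamp_a_square, of "[(Gen_a, False)]"]
    by (simp add: pres_eq.sym)
  also have "\<dots> \<approx> [(Gen_a, True)]"
    using pres_eq.cancel[of lamplighter_relators "[]" Gen_a False "[(Gen_a, True)]"] by simp
  finally show ?thesis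
    using False by simp
qed (simp add: pres_eq.refl)

lemma lamp_conj_square: "lamp_conj i @ lamp_conj i \<approx> []"
proof -
  let ?t = "letter_power Gen_t i" and ?t' = "word_inv (letter_power Gen_t i)"
  have "?t @ [(Gen_a, True)] @ (?t' @ ?t) @ [(Gen_a, True)] @ ?t'
      \<approx> ?t @ [(Gen_a, True), (Gen_a, True)] @ ?t'"
    using pres_eq_in_context[OF pres_eq_word_inv_left,
        of lamplighter_relators "?t @ [(Gen_a, True)]" ?t "[(Gen_a, True)] @ ?t'"] by simp
  also have "\<dots> \<approx> ?t @ ?t'"
    using pres_eq_in_context[OF lamp_a_square, of ?t ?t'] by simp
  also have "\<dots> \<approx> []"
    by (rule pres_eq_word_inv_right)
  finally show ?thesis
    by (simp add: lamp_conj_def letter_power_uminus)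
qed

text \<open>With u and v the two conjugates, the commutator relator followed by v u equals v u,
  while free cancellation reduces the same word to u v.\<close>

lemma lamp_conj_commute: "lamp_conj i @ lamp_conj j \<approx> lamp_conj j @ lamp_conj i"
proof -
  let ?u = "lamp_conj i" and ?v = "lamp_conj j"
  have "word_commutator ?u ?v \<in> lamplighter_relators"
    by (auto simp: lamplighter_relators_def)
  from pres_eq.relator[OF this, of "[]" "?v @ ?u"]
  have 1: "?u @ ?v @ word_inv ?u @ word_inv ?v @ ?v @ ?u \<approx> ?v @ ?u"
    by (simp add: word_commutator_def)
  have "?u @ ?v @ word_inv ?u @ word_inv ?v @ ?v @ ?u \<approx> ?u @ ?v @ word_inv ?u @ ?u"
    using pres_eq_in_context[OF pres_eq_word_inv_left,
        of lamplighter_relators "?u @ ?v @ word_inv ?u" ?v ?u] by simp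
  also have "\<dots> \<approx> ?u @ ?v"
    using pres_eq_in_context[OF pres_eq_word_inv_left,
        of lamplighter_relators "?u @ ?v" ?u "[]"] by simp
  finally show ?thesis
    using 1 pres_eq.sym pres_eq.trans by metis
qed

abbreviation lamp_conjs :: "int list \<Rightarrow> lamp_gen gword" where
  "lamp_conjs is \<equiv> concat (map lamp_conj is)"

lemma lamp_conjs_commute: "lamp_conjs is @ lamp_conj j \<approx> lamp_conj j @ lamp_conjs is"
proof (induction "is")
  case (Cons i "is")
  have "lamp_conj i @ lamp_conjs is @ lamp_conj j \<approx> lamp_conj i @ lamp_conj j @ lamp_conjs is"
    using Cons pres_eq_append_left by blast
  also have "\<dots> \<approx> lamp_conj j @ lamp_conj i @ lamp_conjs is"
    using pres_eq_append_right[OF lamp_conj_commute, of i j "lamp_conjs is"] by simp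
  finally show ?case
    by simp
qed (simp add: pres_eq.refl)

text \<open>Each conjugate toggles the lamp at its own offset from the position, so only the parity
  of its multiplicity survives; the inequality of truth values is exclusive or.\<close>

lemma lamp_run_lamp_conjs:
  "lamp_run (lamp_conjs is) (f, p) = (\<lambda>i. f i \<noteq> odd (count_list is (i - p)), p)"
  by (induction "is" arbitrary: f) (auto simp: lamp_run_lamp_conj fun_eq_iff)

text \<open>The first index must occur again. Commuting its second occurrence to the front cancels
  the pair by \<open>lamp_conj_square\<close> and leaves a list shorter by two with the same
  parities.\<close>

lemma lamp_conjs_even: "(\<And>i. even (count_list is i)) \<Longrightarrow> lamp_conjs is \<approx> []"
proof (induction "length is" arbitrary: "is" rule: less_induct)
  case less
  show ?case
  proof (cases "is")
    case Nil
    then show ?thesis by (simp add: pres_eq.refl)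
  next
    case (Cons j js)
    have "odd (count_list js j)"
      using less.prems[of j] Cons by simp
    then have "j \<in> set js"
      using count_notin even_zero by metis
    then obtain us vs where js: "js = us @ j # vs"
      by (meson split_list)
    have "even (count_list (us @ vs) i)" for i
      using less.prems[of i] by (auto simp: Cons js split: if_splits)
    then have 1: "lamp_conjs (us @ vs) \<approx> []"
      using less.hyps[of "us @ vs"] by (simp add: Cons js)
    have "lamp_conjs is \<approx> lamp_conj j @ lamp_conj j @ lamp_conjs (us @ vs)"
      using pres_eq_in_context[OF lamp_conjs_commute, of "lamp_conj j" us j "lamp_conjs vs"]
      by (simp add: Cons js)
    also have "\<dots> \<approx> lamp_conjs (us @ vs)"
      using pres_eq_append_right[OF lamp_conj_square, of j "lamp_conjs (us @ vs)"] by simp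
    also note 1
    finally show ?thesis .
  qed
qed

text \<open>The word is read from left to right: a letter t changes the exponent p, and a letter a
  read at exponent p contributes the conjugate \<open>lamp_conj p\<close>.\<close>

lemma lamp_normal_form: "\<exists>is p. u \<approx> lamp_conjs is @ letter_power Gen_t p"
proof (induction u rule: rev_induct)
  case Nil
  have "[] \<approx> lamp_conjs [] @ letter_power Gen_t 0"
    by (simp add: letter_power_def pres_eq.refl)
  then show ?case by blast
next
  case (snoc y u)
  obtain x b where y: "y = (x, b)" by fastforce
  obtain "is" p where u: "u \<approx> lamp_conjs is @ letter_power Gen_t p"
    using snoc by blast
  let ?t = "letter_power Gen_t p"
  have uy: "u @ [y] \<approx> lamp_conjs is @ ?t @ [(x, b)]"
    using pres_eq_append_right[OF u, of "[y]"] by (simp add: y)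
  show ?case
  proof (cases x)
    case Gen_t
    note uy
    also have "lamp_conjs is @ ?t @ [(x, b)]
        \<approx> lamp_conjs is @ letter_power Gen_t (if b then p + 1 else p - 1)"
      unfolding Gen_t by (rule pres_eq_append_left[OF letter_power_snoc])
    finally show ?thesis by blast
  next
    case Gen_a
    note uy
    also have "lamp_conjs is @ ?t @ [(x, b)] \<approx> lamp_conjs is @ ?t @ [(Gen_a, True)]"
      using pres_eq_append_left[OF lamp_a_involution, of "lamp_conjs is @ ?t" b]
      by (simp add: Gen_a)
    \<comment> \<open>Inserting the trivial word t^-p t^p after the letter a completes the conjugate
      and restores t^p.\<close>
    also have "\<dots> \<approx> lamp_conjs (is @ [p]) @ ?t"
      using pres_eq_append_left[OF pres_eq_word_inv_left,
          of lamplighter_relators "lamp_conjs is @ ?t @ [(Gen_a, True)]" ?t]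
      by (simp add: lamp_conj_def letter_power_uminus pres_eq.sym)
    finally show ?thesis by blast
  qed
qed

section \<open>Faithfulness of the action and coordinates for group elements\<close>

text \<open>The final state determines the normal form up to parity: the position forces
  \<open>p = 0\<close>, and the dark lamps force even multiplicities, so all conjugates
  cancel.\<close>

lemma lamp_run_eq_start:
  assumes "lamp_run u lamp_start = lamp_start"
  shows "u \<approx> []"
proof -
  obtain "is" p where u: "u \<approx> lamp_conjs is @ letter_power Gen_t p"
    using lamp_normal_form by blast
  from lamp_run_pres_eq[OF this, of lamp_start] assms
  have "p = 0" and "even (count_list is i)" for i
    by (auto simp: lamp_run_lamp_conjs lamp_run_letter_power_t fun_eq_iff)
  then show ?thesis
    using u lamp_conjs_even[of "is"] pres_eq.trans[OF u] by (simp add: letter_power_def)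
qed

text \<open>If both words reach the same state, then \<open>u @ word_inv v\<close> returns to the
  start, so the previous lemma makes it trivial.\<close>

lemma lamp_run_start_eq_iff: "lamp_run u lamp_start = lamp_run v lamp_start \<longleftrightarrow> u \<approx> v"
proof
  assume *: "lamp_run u lamp_start = lamp_run v lamp_start"
  have "u @ word_inv v \<approx> []"
    by (rule lamp_run_eq_start) (simp add: * lamp_run_word_inv)
  have "u \<approx> u @ word_inv v @ v"
    using pres_eq_append_left[OF pres_eq_word_inv_left, of lamplighter_relators u v]
    by (simp add: pres_eq.sym)
  also have "\<dots> \<approx> v"
    using pres_eq_append_right[OF \<open>u @ word_inv v \<approx> []\<close>, of v] by simp
  finally show "u \<approx> v" .
qed (rule lamp_run_pres_eq)

abbreviation lamp_class :: "lamp_gen gword \<Rightarrow> lamp_gen gword set" where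
  "lamp_class \<equiv> pres_class lamplighter_relators"

text \<open>The choice of the representing word is immaterial by
  \<open>lamp_run_start_eq_iff\<close>.\<close>

definition state_of :: "lamp_gen gword set \<Rightarrow> lamp_state" where
  "state_of x = lamp_run (SOME u. x = lamp_class u) lamp_start"

lemma state_of_class: "state_of (lamp_class u) = lamp_run u lamp_start"
proof -
  have "lamp_class u = lamp_class (SOME v. lamp_class u = lamp_class v)"
    by (rule someI) simp
  then show ?thesis
    by (simp add: state_of_def pres_class_eq_iff lamp_run_start_eq_iff pres_eq.sym)
qed

lemma carrier_lamplighter: "carrier lamplighter = range lamp_class"
  by (simp add: lamplighter_def carrier_presented_group)

lemma mult_lamplighter: "lamp_class u \<otimes>\<^bsub>lamplighter\<^esub> lamp_class v = lamp_class (u @ v)"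
  by (simp add: lamplighter_def mult_presented_group)

lemma one_lamplighter: "\<one>\<^bsub>lamplighter\<^esub> = lamp_class []"
  by (simp add: lamplighter_def one_presented_group)

lemma state_of_inj:
  "x \<in> carrier lamplighter \<Longrightarrow> y \<in> carrier lamplighter \<Longrightarrow> state_of x = state_of y \<Longrightarrow> x = y"
  unfolding carrier_lamplighter
  by (elim imageE) (simp add: state_of_class lamp_run_start_eq_iff pres_class_eq_iff)

lemma state_of_mult:
  "x \<in> carrier lamplighter \<Longrightarrow>
    state_of (x \<otimes>\<^bsub>lamplighter\<^esub> lamp_class u) = lamp_run u (state_of x)"
  by (auto simp: carrier_lamplighter mult_lamplighter state_of_class)

lemma inv_lamp_class: "inv\<^bsub>lamplighter\<^esub> lamp_class u = lamp_class (word_inv u)"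
  by (rule group.inv_equality[OF group_lamplighter])
    (auto simp: mult_lamplighter one_lamplighter carrier_lamplighter pres_class_eq_iff
      pres_eq_word_inv_left)

section \<open>Generators as moves along the line\<close>

abbreviation lamp_gens :: "lamp_gen gword set set" where
  "lamp_gens \<equiv> {lamp_t, lamp_t \<otimes>\<^bsub>lamplighter\<^esub> lamp_a}"

abbreviation lamp_inverses :: "lamp_gen gword set set" where
  "lamp_inverses \<equiv>
    {inv\<^bsub>lamplighter\<^esub> lamp_t, lamp_a \<otimes>\<^bsub>lamplighter\<^esub> inv\<^bsub>lamplighter\<^esub> lamp_t}"

lemma lamp_gens_eq:
  "lamp_gens = {lamp_class [(Gen_t, True)], lamp_class [(Gen_t, True), (Gen_a, True)]}"
  by (simp add: lamp_a_def lamp_t_def mult_lamplighter)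

lemma lamp_inverses_eq:
  "lamp_inverses = {lamp_class [(Gen_t, False)], lamp_class [(Gen_a, True), (Gen_t, False)]}"
  by (simp add: lamp_a_def lamp_t_def mult_lamplighter inv_lamp_class word_inv_def)

lemma m_inv_lamp_gens: "m_inv lamplighter ` lamp_gens = lamp_inverses"
proof -
  have "[(Gen_a, False), (Gen_t, False)] \<approx> [(Gen_a, True), (Gen_t, False)]"
    using pres_eq_append_right[OF lamp_a_involution] by fastforce
  then have "lamp_class [(Gen_a, False), (Gen_t, False)] = lamp_class [(Gen_a, True), (Gen_t, False)]"
    by (simp add: pres_class_eq_iff)
  then show ?thesis
    unfolding lamp_gens_eq lamp_inverses_eq by (simp add: inv_lamp_class word_inv_def)
qed

lemma lamp_gens_carrier: "lamp_gens \<subseteq> carrier lamplighter"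
  by (auto simp: lamp_gens_eq carrier_lamplighter simp del: insert_subset)

lemma lamp_inverses_carrier: "lamp_inverses \<subseteq> carrier lamplighter"
  by (auto simp: lamp_inverses_eq carrier_lamplighter simp del: insert_subset)

text \<open>One generator keeps the lamp at \<open>p + 1\<close> and the other toggles it, so
  together they allow a free choice of its new value.\<close>

lemma state_of_lamp_gens:
  assumes "x \<in> carrier lamplighter" and "state_of x = (f, p)"
  shows "(\<exists>g\<in>lamp_gens. state_of (x \<otimes>\<^bsub>lamplighter\<^esub> g) = s) \<longleftrightarrow> (\<exists>b. s = (f(p + 1 := b), p + 1))"
    (is "?lhs \<longleftrightarrow> ?rhs")
proof -
  have "?lhs \<longleftrightarrow> s = (f(p + 1 := f (p + 1)), p + 1) \<or> s = (f(p + 1 := \<not> f (p + 1)), p + 1)"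
    unfolding lamp_gens_eq by (auto simp: state_of_mult assms)
  also have "\<dots> \<longleftrightarrow> ?rhs"
    by (cases "f (p + 1)") (auto simp: ex_bool_eq simp del: fun_upd_triv)
  finally show ?thesis .
qed

text \<open>Here the toggle precedes the move, so the lamp affected is again the one at the right
  endpoint of the crossed edge, which is now \<open>p\<close>.\<close>

lemma state_of_lamp_inverses:
  assumes "x \<in> carrier lamplighter" and "state_of x = (f, p)"
  shows "(\<exists>h\<in>lamp_inverses. state_of (x \<otimes>\<^bsub>lamplighter\<^esub> h) = s) \<longleftrightarrow> (\<exists>b. s = (f(p := b), p - 1))"
    (is "?lhs \<longleftrightarrow> ?rhs")
proof -
  have "?lhs \<longleftrightarrow> s = (f(p := f p), p - 1) \<or> s = (f(p := \<not> f p), p - 1)"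
    unfolding lamp_inverses_eq by (auto simp: state_of_mult assms)
  also have "\<dots> \<longleftrightarrow> ?rhs"
    by (cases "f p") (auto simp: ex_bool_eq simp del: fun_upd_triv)
  finally show ?thesis .
qed

lemma state_of_mult_lamp_gen:
  assumes "x \<in> carrier lamplighter" and "state_of x = (f, p)" and "g \<in> lamp_gens"
  shows "\<exists>b. state_of (x \<otimes>\<^bsub>lamplighter\<^esub> g) = (f(p + 1 := b), p + 1)"
  using assms(3) by (intro iffD1[OF state_of_lamp_gens[OF assms(1,2)]] bexI[of _ g] HOL.refl)

lemma state_of_mult_lamp_inverse:
  assumes "x \<in> carrier lamplighter" and "state_of x = (f, p)" and "h \<in> lamp_inverses"
  shows "\<exists>b. state_of (x \<otimes>\<^bsub>lamplighter\<^esub> h) = (f(p := b), p - 1)"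
  using assms(3) by (intro iffD1[OF state_of_lamp_inverses[OF assms(1,2)]] bexI[of _ h] HOL.refl)

text \<open>The edges of the Cayley graph in lamp coordinates, with the generator forgotten.\<close>

inductive lamp_move :: "lamp_state \<Rightarrow> lamp_state \<Rightarrow> bool" where
  right: "lamp_move (f, p) (f(p + 1 := b), p + 1)"
| left: "lamp_move (f, p) (f(p := b), p - 1)"

lemma lamp_move_iff:
  assumes "x \<in> carrier lamplighter"
  shows "lamp_move (state_of x) s \<longleftrightarrow>
    (\<exists>g \<in> lamp_gens \<union> m_inv lamplighter ` lamp_gens. state_of (x \<otimes>\<^bsub>lamplighter\<^esub> g) = s)"
proof -
  obtain f p where "state_of x = (f, p)" by fastforce
  then show ?thesis
    unfolding m_inv_lamp_gens bex_Un
    by (simp add: state_of_lamp_gens[OF assms] state_of_lamp_inverses[OF assms] lamp_move.simps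
        del: bex_simps)
qed

lemma (in monoid) foldl_mult_closed:
  "x \<in> carrier G \<Longrightarrow> set ys \<subseteq> carrier G \<Longrightarrow> foldl (\<otimes>) x ys \<in> carrier G"
  by (induction ys arbitrary: x) auto

text \<open>Bridges \<open>word_length\<close>, which multiplies with \<open>foldr\<close>, and
  paths, which grow by a factor on the right as \<open>foldl\<close> does.\<close>

lemma (in monoid) foldl_mult_eq_foldr:
  "x \<in> carrier G \<Longrightarrow> set ys \<subseteq> carrier G \<Longrightarrow> foldl (\<otimes>) x ys = x \<otimes> foldr (\<otimes>) ys \<one>"
proof (induction ys arbitrary: x)
  case (Cons y ys)
  have "foldr (\<otimes>) zs \<one> \<in> carrier G" if "set zs \<subseteq> carrier G" for zs
    using that by (induction zs) auto
  then show ?case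
    using Cons by (simp add: m_assoc)
qed simp

text \<open>Turns word length into distance in the move graph: the last letter of a word is the last
  move of a path, and injectivity of \<open>state_of\<close> recovers the element from its
  state.\<close>

lemma lamp_moves_iff:
  assumes "x \<in> carrier lamplighter"
  shows "(\<exists>xs. length xs = n \<and> set xs \<subseteq> lamp_gens \<union> m_inv lamplighter ` lamp_gens \<and>
      foldr (mult lamplighter) xs \<one>\<^bsub>lamplighter\<^esub> = x)
    \<longleftrightarrow> (lamp_move ^^ n) lamp_start (state_of x)" (is "?lhs \<longleftrightarrow> _")
proof -
  let ?S = "lamp_gens \<union> m_inv lamplighter ` lamp_gens"
  let ?prod = "foldl (mult lamplighter) \<one>\<^bsub>lamplighter\<^esub>"
  interpret L: group lamplighter by (rule group_lamplighter)
  have S: "?S \<subseteq> carrier lamplighter"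
    using lamp_gens_carrier lamp_inverses_carrier by (simp only: m_inv_lamp_gens Un_least)
  have closed: "?prod xs \<in> carrier lamplighter" if "set xs \<subseteq> ?S" for xs
    using that S by (intro L.foldl_mult_closed) auto
  \<comment> \<open>The target is an arbitrary state \<open>s\<close>, so that the induction applies
    to the intermediate states of a path.\<close>
  have moves: "(\<exists>xs. length xs = n \<and> set xs \<subseteq> ?S \<and> state_of (?prod xs) = s)
      \<longleftrightarrow> (lamp_move ^^ n) lamp_start s" for s
  proof (induction n arbitrary: s)
    case 0
    show ?case
      by (auto simp: one_lamplighter state_of_class)
  next
    case (Suc n)
    show ?case
    proof
      assume "\<exists>xs. length xs = Suc n \<and> set xs \<subseteq> ?S \<and> state_of (?prod xs) = s"
      then obtain xs where xs: "length xs = Suc n" "set xs \<subseteq> ?S" "state_of (?prod xs) = s"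
        by blast
      then obtain ys g where "xs = ys @ [g]"
        by (auto simp: length_Suc_conv_rev)
      with xs have ys: "length ys = n" "set ys \<subseteq> ?S"
        and g: "g \<in> ?S" "state_of (?prod ys \<otimes>\<^bsub>lamplighter\<^esub> g) = s"
        by simp_all
      have "(lamp_move ^^ n) lamp_start (state_of (?prod ys))"
        using Suc ys by blast
      moreover have "lamp_move (state_of (?prod ys)) s"
        using lamp_move_iff[OF closed[OF ys(2)]] g by blast
      ultimately show "(lamp_move ^^ Suc n) lamp_start s"
        by (rule relpowp_Suc_I)
    next
      assume "(lamp_move ^^ Suc n) lamp_start s"
      then obtain s' where "(lamp_move ^^ n) lamp_start s'" and s': "lamp_move s' s"
        by (rule relpowp_Suc_E)
      then obtain ys where ys: "length ys = n" "set ys \<subseteq> ?S" "state_of (?prod ys) = s'"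
        using Suc by blast
      from s' obtain g where "g \<in> ?S" "state_of (?prod ys \<otimes>\<^bsub>lamplighter\<^esub> g) = s"
        unfolding ys(3)[symmetric] by (rule lamp_move_iff[OF closed[OF ys(2)], THEN iffD1, THEN bexE])
      then show "\<exists>xs. length xs = Suc n \<and> set xs \<subseteq> ?S \<and> state_of (?prod xs) = s"
        using ys by (intro exI[of _ "ys @ [g]"]) simp
    qed
  qed
  have iff: "foldr (mult lamplighter) xs \<one>\<^bsub>lamplighter\<^esub> = x \<longleftrightarrow> state_of (?prod xs) = state_of x"
    if "set xs \<subseteq> ?S" for xs
  proof -
    have "foldr (mult lamplighter) xs \<one>\<^bsub>lamplighter\<^esub> \<in> carrier lamplighter"
      using that S by (induction xs) auto
    then have "foldr (mult lamplighter) xs \<one>\<^bsub>lamplighter\<^esub> = ?prod xs"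
      using that S by (subst L.foldl_mult_eq_foldr) auto
    then show ?thesis
      using state_of_inj[OF closed[OF that] assms] by metis
  qed
  have "?lhs \<longleftrightarrow> (\<exists>xs. length xs = n \<and> set xs \<subseteq> ?S \<and> state_of (?prod xs) = state_of x)"
    by (intro ex_cong1 conj_cong HOL.refl iff)
  then show ?thesis
    by (simp only: moves)
qed

text \<open>Later yields a group element from a path to its intended state, without writing down a
  word.\<close>

lemma lamp_moves_surj:
  assumes "(lamp_move ^^ n) lamp_start s"
  shows "\<exists>x \<in> carrier lamplighter. state_of x = s"
  using assms
proof (induction n arbitrary: s)
  case 0
  then show ?case
    by (intro bexI[of _ "lamp_class []"]) (auto simp: state_of_class carrier_lamplighter)
next
  case (Suc n)
  interpret L: group lamplighter by (rule group_lamplighter)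
  from Suc obtain x where x: "x \<in> carrier lamplighter" "lamp_move (state_of x) s"
    by (metis relpowp_Suc_E)
  then show ?case
    using lamp_move_iff[OF x(1), of s] lamp_gens_carrier lamp_inverses_carrier
    unfolding m_inv_lamp_gens by blast
qed

section \<open>The length formula from shortest paths\<close>

text \<open>Here - m and M are the extreme positions visited; a step inside the visited interval changes
  the left-hand side by at most 1, and so does a step that enlarges the interval, because the
  increase by 2 is then compensated by the growth of |p|.\<close>

lemma lamp_moves_lower:
  assumes "(lamp_move ^^ n) lamp_start (f, p)"
  shows "\<exists>m M. 0 \<le> m \<and> 0 \<le> M \<and> - m \<le> p \<and> p \<le> M \<and> (\<forall>i. f i \<longrightarrow> 1 - m \<le> i \<and> i \<le> M) \<and>
    2 * (M + m) - \<bar>p\<bar> \<le> int n"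
  using assms
proof (induction n arbitrary: f p)
  case 0
  then show ?case by (intro exI[of _ 0]) auto
next
  case (Suc n)
  then obtain f' p' where prev: "(lamp_move ^^ n) lamp_start (f', p')" and step: "lamp_move (f', p') (f, p)"
    by (metis relpowp_Suc_E surj_pair)
  then obtain m M where IH: "0 \<le> m" "0 \<le> M" "- m \<le> p'" "p' \<le> M"
    "\<And>i. f' i \<Longrightarrow> 1 - m \<le> i \<and> i \<le> M" "2 * (M + m) - \<bar>p'\<bar> \<le> int n"
    using Suc.IH[OF prev] by blast
  from step show ?case
  proof cases
    case (right b)
    then have "1 - m \<le> i \<and> i \<le> max M p" if "f i" for i
      using that IH(1-4) IH(5)[of i] by (auto split: if_splits)
    moreover have "- m \<le> p" "2 * (max M p + m) - \<bar>p\<bar> \<le> int (Suc n)"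
      using right IH(1-4,6) by (cases "p \<le> M"; simp)+
    ultimately show ?thesis
      using IH(1,2) by - (rule exI[of _ m], rule exI[of _ "max M p"], simp)
  next
    \<comment> \<open>A left step writes the lamp at the old position, which is \<open>p + 1\<close>
      for the new position \<open>p\<close>; hence the bound \<open>1 - max m (- p)\<close>.\<close>
    case (left b)
    then have "1 - max m (- p) \<le> i \<and> i \<le> M" if "f i" for i
      using that IH(1-4) IH(5)[of i] by (auto split: if_splits)
    moreover have "- max m (- p) \<le> p" "p \<le> M" "2 * (M + max m (- p)) - \<bar>p\<bar> \<le> int (Suc n)"
      using left IH(1-4,6) by (cases "- m \<le> p"; simp)+
    ultimately show ?thesis
      using IH(1,2) by - (rule exI[of _ "max m (- p)"], rule exI[of _ M], simp)
  qed
qed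

text \<open>A sweep crosses \<open>n\<close> consecutive edges and can leave each of them in any
  state at no extra cost.\<close>

lemma lamp_moves_right:
  assumes "\<And>i. f' i \<noteq> f i \<Longrightarrow> p < i \<and> i \<le> p + int n"
  shows "(lamp_move ^^ n) (f, p) (f', p + int n)"
  using assms
proof (induction n arbitrary: f')
  case 0
  then have "f' = f" by fastforce
  then show ?case by simp
next
  case (Suc n)
  let ?i = "p + int (Suc n)"
  \<comment> \<open>The first \<open>n\<close> moves settle every lamp except \<open>?i\<close>,
    which only the final move writes.\<close>
  have "(lamp_move ^^ n) (f, p) (f'(?i := f ?i), p + int n)"
    using Suc.prems by (intro Suc.IH) (fastforce split: if_splits)
  moreover have "lamp_move (f'(?i := f ?i), p + int n) (f', ?i)"
    using lamp_move.right[of "f'(?i := f ?i)" "p + int n" "f' ?i"] by (simp add: add_ac)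
  ultimately show ?case
    by (rule relpowp_Suc_I)
qed

lemma lamp_moves_left:
  assumes "\<And>i. f' i \<noteq> f i \<Longrightarrow> p - int n < i \<and> i \<le> p"
  shows "(lamp_move ^^ n) (f, p) (f', p - int n)"
  using assms
proof (induction n arbitrary: f')
  case 0
  then have "f' = f" by fastforce
  then show ?case by simp
next
  case (Suc n)
  let ?i = "p - int n"
  have "(lamp_move ^^ n) (f, p) (f'(?i := f ?i), ?i)"
    using Suc.prems by (intro Suc.IH) (fastforce split: if_splits)
  moreover have "lamp_move (f'(?i := f ?i), ?i) (f', p - int (Suc n))"
    using lamp_move.left[of "f'(?i := f ?i)" ?i "f' ?i"] by (simp add: algebra_simps)
  ultimately show ?case
    by (rule relpowp_Suc_I)
qed

text \<open>The path visits the far end of the interval on the side opposite to p first.\<close>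

lemma lamp_moves_upper:
  assumes "0 \<le> m" "0 \<le> M" "- m \<le> p" "p \<le> M" and f: "\<And>i. f i \<Longrightarrow> 1 - m \<le> i \<and> i \<le> M"
  shows "(lamp_move ^^ nat (2 * (M + m) - \<bar>p\<bar>)) lamp_start (f, p)"
proof (cases "p \<ge> 0")
  case True
  have "(lamp_move ^^ nat m) lamp_start (\<lambda>_. False, - m)"
    using lamp_moves_left[of "\<lambda>_. False" "\<lambda>_. False" 0 "nat m"] assms by simp
  \<comment> \<open>This sweep crosses the whole interval, so it writes all of
    \<open>f\<close>.\<close>
  moreover have "(lamp_move ^^ nat (M + m)) (\<lambda>_. False, - m) (f, M)"
    using lamp_moves_right[of f "\<lambda>_. False" "- m" "nat (M + m)"] assms by fastforce
  moreover have "(lamp_move ^^ nat (M - p)) (f, M) (f, p)"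
    using lamp_moves_left[of f f M "nat (M - p)"] assms by simp
  ultimately have "(lamp_move ^^ (nat m + nat (M + m) + nat (M - p))) lamp_start (f, p)"
    by (meson relpowp_trans)
  also have "nat m + nat (M + m) + nat (M - p) = nat (2 * (M + m) - \<bar>p\<bar>)"
    using assms(1-4) True by (simp add: algebra_simps flip: nat_add_distrib)
  finally show ?thesis .
next
  case False
  have "(lamp_move ^^ nat M) lamp_start (\<lambda>_. False, M)"
    using lamp_moves_right[of "\<lambda>_. False" "\<lambda>_. False" 0 "nat M"] assms by simp
  moreover have "(lamp_move ^^ nat (M + m)) (\<lambda>_. False, M) (f, - m)"
    using lamp_moves_left[of f "\<lambda>_. False" M "nat (M + m)"] assms by fastforce
  moreover have "(lamp_move ^^ nat (p + m)) (f, - m) (f, p)"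
    using lamp_moves_right[of f f "- m" "nat (p + m)"] assms by simp
  ultimately have "(lamp_move ^^ (nat M + nat (M + m) + nat (p + m))) lamp_start (f, p)"
    by (meson relpowp_trans)
  also have "nat M + nat (M + m) + nat (p + m) = nat (2 * (M + m) - \<bar>p\<bar>)"
    using assms(1-4) False by (simp add: algebra_simps flip: nat_add_distrib)
  finally show ?thesis .
qed

text \<open>The last two hypotheses make the interval from \<open>- m\<close> to \<open>M\<close>
  tight: every path ending in this state must cover it, so the lower bound meets the upper one. The
  end lamp is \<open>1 - m\<close> because the edge from \<open>- m\<close> to \<open>1 - m\<close>
  carries the lamp of its right endpoint.\<close>

lemma lamp_word_length:
  assumes "x \<in> carrier lamplighter" and x: "state_of x = (f, p)"
    and "0 \<le> m" "0 \<le> M" "- m \<le> p" "p \<le> M" and f: "\<And>i. f i \<Longrightarrow> 1 - m \<le> i \<and> i \<le> M"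
    and M: "f M \<or> p = M" and m: "f (1 - m) \<or> p = - m"
  shows "int (word_length lamplighter lamp_gens x) = 2 * (M + m) - \<bar>p\<bar>"
proof -
  have "word_length lamplighter lamp_gens x = nat (2 * (M + m) - \<bar>p\<bar>)"
    unfolding word_length_def lamp_moves_iff[OF assms(1)] x
  proof (rule Least_equality)
    show "(lamp_move ^^ nat (2 * (M + m) - \<bar>p\<bar>)) lamp_start (f, p)"
      using assms(3-6) f by (rule lamp_moves_upper)
  next
    fix n assume "(lamp_move ^^ n) lamp_start (f, p)"
    then obtain m' M' where "- m' \<le> p" "p \<le> M'" "\<forall>i. f i \<longrightarrow> 1 - m' \<le> i \<and> i \<le> M'"
      and n: "2 * (M' + m') - \<bar>p\<bar> \<le> int n"
      using lamp_moves_lower[of n f p] by blast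
    then have "M \<le> M'" "m \<le> m'"
      using m M by force+
    with n show "nat (2 * (M + m) - \<bar>p\<bar>) \<le> n"
      by (simp add: nat_le_iff)
  qed
  moreover have "0 \<le> 2 * (M + m) - \<bar>p\<bar>"
    using assms(3-6) by (simp add: abs_if)
  ultimately show ?thesis by simp
qed

section \<open>The element w and the paths leaving it\<close>

text \<open>Whichever generators are chosen, only lamps on crossed edges can change; this is all
  that is needed about the resulting configuration.\<close>

lemma state_of_foldl_lamp_gens:
  assumes "w \<in> carrier lamplighter" and "state_of w = (f, p)" and "set gs \<subseteq> lamp_gens"
  shows "\<exists>f'. state_of (foldl (mult lamplighter) w gs) = (f', p + int (length gs)) \<and>
    (\<forall>i. f' i \<noteq> f i \<longrightarrow> p < i \<and> i \<le> p + int (length gs))"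
  using assms(3)
proof (induction gs rule: rev_induct)
  case Nil
  then show ?case by (simp add: assms(2))
next
  case (snoc g gs)
  interpret L: group lamplighter by (rule group_lamplighter)
  let ?x = "foldl (mult lamplighter) w gs"
  have "?x \<in> carrier lamplighter"
    using snoc.prems lamp_gens_carrier assms(1) by (intro L.foldl_mult_closed) auto
  moreover obtain f' where f': "state_of ?x = (f', p + int (length gs))"
    "\<And>i. f' i \<noteq> f i \<Longrightarrow> p < i \<and> i \<le> p + int (length gs)"
    using snoc by auto
  moreover have "g \<in> lamp_gens"
    using snoc.prems by simp
  ultimately obtain b where "state_of (?x \<otimes>\<^bsub>lamplighter\<^esub> g)
      = (f'(p + int (length gs) + 1 := b), p + int (length gs) + 1)"
    using state_of_mult_lamp_gen by blast
  then show ?case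
    using f'(2) by (fastforce simp: add_ac)
qed

lemma state_of_foldl_lamp_inverses:
  assumes "w \<in> carrier lamplighter" and "state_of w = (f, p)" and "set hs \<subseteq> lamp_inverses"
  shows "\<exists>f'. state_of (foldl (mult lamplighter) w hs) = (f', p - int (length hs)) \<and>
    (\<forall>i. f' i \<noteq> f i \<longrightarrow> p - int (length hs) < i \<and> i \<le> p)"
  using assms(3)
proof (induction hs rule: rev_induct)
  case Nil
  then show ?case by (simp add: assms(2))
next
  case (snoc h hs)
  interpret L: group lamplighter by (rule group_lamplighter)
  let ?x = "foldl (mult lamplighter) w hs"
  have "?x \<in> carrier lamplighter"
    using snoc.prems lamp_inverses_carrier assms(1) by (intro L.foldl_mult_closed) auto
  moreover obtain f' where f': "state_of ?x = (f', p - int (length hs))"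
    "\<And>i. f' i \<noteq> f i \<Longrightarrow> p - int (length hs) < i \<and> i \<le> p"
    using snoc by auto
  moreover have "h \<in> lamp_inverses"
    using snoc.prems by simp
  ultimately obtain b where "state_of (?x \<otimes>\<^bsub>lamplighter\<^esub> h)
      = (f'(p - int (length hs) := b), p - int (length hs) - 1)"
    using state_of_mult_lamp_inverse by blast
  then show ?case
    using f'(2) by (fastforce simp: algebra_simps)
qed

theorem theorem3p6:
  fixes L :: "lamp_gen gword set monoid" (structure)
    and a t :: "lamp_gen gword set"
    and len :: "lamp_gen gword set \<Rightarrow> int"
    and k :: nat
  defines "L \<equiv> lamplighter"
    and "a \<equiv> lamp_a"
    and "t \<equiv> lamp_t"
    and "len \<equiv> (\<lambda>x. int (word_length L {t, t \<otimes> a} x))"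
  assumes "k \<ge> 1"
  shows "\<exists>w \<in> carrier L.
    (\<forall>g \<in> {t, t \<otimes> a}. len (w \<otimes> g) = len w - 1 \<and> len (w \<otimes> inv g) = len w - 1) \<and>
    (\<forall>l \<in> {1..k}. \<forall>gs. length gs = l \<and> set gs \<subseteq> {t, t \<otimes> a} \<longrightarrow>
       len (foldl (\<otimes>) w gs) = len w - int l) \<and>
    (\<forall>l \<in> {1..k - 1}. \<forall>gs. \<forall>h \<in> {inv t, a \<otimes> inv t}.
       length gs = l \<and> set gs \<subseteq> {t, t \<otimes> a} \<longrightarrow>
       len (foldl (\<otimes>) w gs \<otimes> h) = len w - int l + 1) \<and>
    (\<forall>l \<in> {1..k}. \<forall>hs. length hs = l \<and> set hs \<subseteq> {inv t, a \<otimes> inv t} \<longrightarrow>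
       len (foldl (\<otimes>) w hs) = len w - int l) \<and>
    (\<forall>l \<in> {1..k - 1}. \<forall>hs. \<forall>g \<in> {t, t \<otimes> a}.
       length hs = l \<and> set hs \<subseteq> {inv t, a \<otimes> inv t} \<longrightarrow>
       len (foldl (\<otimes>) w hs \<otimes> g) = len w - int l + 1)"
proof -
  \<comment> \<open>These lamps sit on the outermost edges of the interval from
    \<open>- int k\<close> to \<open>int k\<close>; hence \<open>1 - int k\<close> on the
    left.\<close>
  let ?f = "\<lambda>i. i = int k \<or> i = 1 - int k"
  interpret L: group L
    unfolding L_def by (rule group_lamplighter)
  have gens: "{t, t \<otimes> a} = lamp_gens" and inverses: "{inv t, a \<otimes> inv t} = lamp_inverses"
    by (simp_all only: L_def a_def t_def)
  note moves = lamp_gens_carrier[folded gens L_def] lamp_inverses_carrier[folded inverses L_def]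
  have gen_step: "\<exists>b. state_of (x \<otimes> g) = (f(p + 1 := b), p + 1)"
    if "x \<in> carrier L" "state_of x = (f, p)" "g \<in> {t, t \<otimes> a}" for x f p g
    using that unfolding gens unfolding L_def by (rule state_of_mult_lamp_gen)
  have inv_step: "\<exists>b. state_of (x \<otimes> h) = (f(p := b), p - 1)"
    if "x \<in> carrier L" "state_of x = (f, p)" "h \<in> {inv t, a \<otimes> inv t}" for x f p h
    using that unfolding inverses unfolding L_def by (rule state_of_mult_lamp_inverse)
  \<comment> \<open>All elements considered below need the same interval, so their lengths differ
    only through the position. The last two assumptions express that each end is still lit or has
    been reached.\<close>
  have len: "len x = 4 * int k - \<bar>p\<bar>"
    if "x \<in> carrier L" "state_of x = (f, p)" "\<bar>p\<bar> \<le> int k"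
      "\<And>i. f i \<noteq> ?f i \<Longrightarrow> 1 - int k \<le> i \<and> i \<le> int k"
      "f (int k) \<or> p = int k" "f (1 - int k) \<or> p = - int k"
    for x f p
  proof -
    have "1 - int k \<le> i \<and> i \<le> int k" if "f i" for i
      using that assms(5) \<open>f i \<noteq> ?f i \<Longrightarrow> 1 - int k \<le> i \<and> i \<le> int k\<close> by fastforce
    then have "int (word_length lamplighter lamp_gens x) = 2 * (int k + int k) - \<bar>p\<bar>"
      using that by (intro lamp_word_length) (auto simp: L_def)
    then show ?thesis
      unfolding len_def gens by (simp add: L_def)
  qed
  have "(lamp_move ^^ nat (2 * (int k + int k) - \<bar>0\<bar>)) lamp_start (?f, 0)"
    using assms(5) by (intro lamp_moves_upper) auto
  then obtain w where w: "w \<in> carrier L" "state_of w = (?f, 0)"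
    using lamp_moves_surj unfolding L_def by blast
  have len_w: "len w = 4 * int k"
    using len[OF w] assms(5) by simp
  \<comment> \<open>The moves alter only lamps from 1 to \<open>length gs\<close>. Lamp
    \<open>1 - int k\<close> stays lit, and lamp \<open>int k\<close> can change only when
    \<open>length gs = k\<close>, that is, when the position is \<open>int k\<close>.\<close>
  have pos: "len (foldl (\<otimes>) w gs) = len w - int (length gs)"
    if "length gs \<le> k" and gs: "set gs \<subseteq> {t, t \<otimes> a}" for gs
  proof -
    obtain f where f: "state_of (foldl (\<otimes>) w gs) = (f, int (length gs))"
      "\<And>i. f i \<noteq> ?f i \<Longrightarrow> 0 < i \<and> i \<le> int (length gs)"
      using state_of_foldl_lamp_gens[of w ?f 0 gs] w gs unfolding gens by (auto simp: L_def)
    have "foldl (\<otimes>) w gs \<in> carrier L"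
      using w(1) gs moves by (intro L.foldl_mult_closed) auto
    from len[OF this f(1)] that(1) f(2) assms(5) show ?thesis
      unfolding len_w by fastforce
  qed
  \<comment> \<open>Symmetrically, lamp \<open>1 - int k\<close> can change only on the
    \<open>k\<close>-th move, which ends at \<open>- int k\<close>.\<close>
  have neg: "len (foldl (\<otimes>) w hs) = len w - int (length hs)"
    if "length hs \<le> k" and hs: "set hs \<subseteq> {inv t, a \<otimes> inv t}" for hs
  proof -
    obtain f where f: "state_of (foldl (\<otimes>) w hs) = (f, - int (length hs))"
      "\<And>i. f i \<noteq> ?f i \<Longrightarrow> - int (length hs) < i \<and> i \<le> 0"
      using state_of_foldl_lamp_inverses[of w ?f 0 hs] w hs unfolding inverses by (auto simp: L_def)
    have "foldl (\<otimes>) w hs \<in> carrier L"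
      using w(1) hs moves by (intro L.foldl_mult_closed) auto
    from len[OF this f(1)] that(1) f(2) assms(5) show ?thesis
      unfolding len_w by fastforce
  qed
  \<comment> \<open>With at most \<open>k - 1\<close> moves made, both end lamps are still lit, and
    the step back writes lamp \<open>length gs\<close>, which is neither of them. The position
    \<open>length gs - 1\<close> is nonnegative, so its absolute value has dropped by one.\<close>
  have pos_neg: "len (foldl (\<otimes>) w gs \<otimes> h) = len w - int (length gs) + 1"
    if l: "1 \<le> length gs" "length gs \<le> k - 1" and gs: "set gs \<subseteq> {t, t \<otimes> a}"
      and h: "h \<in> {inv t, a \<otimes> inv t}" for gs h
  proof -
    obtain f where f: "state_of (foldl (\<otimes>) w gs) = (f, int (length gs))"
      "\<And>i. f i \<noteq> ?f i \<Longrightarrow> 0 < i \<and> i \<le> int (length gs)"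
      using state_of_foldl_lamp_gens[of w ?f 0 gs] w gs unfolding gens by (auto simp: L_def)
    have ends: "f (int k)" "f (1 - int k)"
      using l f(2)[of "int k"] f(2)[of "1 - int k"] by fastforce+
    have x: "foldl (\<otimes>) w gs \<in> carrier L"
      using w(1) gs moves by (intro L.foldl_mult_closed) auto
    then obtain b where "state_of (foldl (\<otimes>) w gs \<otimes> h)
        = (f(int (length gs) := b), int (length gs) - 1)"
      using inv_step f(1) h by blast
    then have "len (foldl (\<otimes>) w gs \<otimes> h) = 4 * int k - \<bar>int (length gs) - 1\<bar>"
    proof (rule len[rotated])
      show "foldl (\<otimes>) w gs \<otimes> h \<in> carrier L"
        using x h moves by blast
      show "1 - int k \<le> i \<and> i \<le> int k" if "(f(int (length gs) := b)) i \<noteq> ?f i" for i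
        using that f(2)[of i] l by (auto split: if_splits)
    qed (use l ends in auto)
    then show ?thesis
      using l len_w by simp
  qed
  have neg_pos: "len (foldl (\<otimes>) w hs \<otimes> g) = len w - int (length hs) + 1"
    if l: "1 \<le> length hs" "length hs \<le> k - 1" and hs: "set hs \<subseteq> {inv t, a \<otimes> inv t}"
      and g: "g \<in> {t, t \<otimes> a}" for hs g
  proof -
    obtain f where f: "state_of (foldl (\<otimes>) w hs) = (f, - int (length hs))"
      "\<And>i. f i \<noteq> ?f i \<Longrightarrow> - int (length hs) < i \<and> i \<le> 0"
      using state_of_foldl_lamp_inverses[of w ?f 0 hs] w hs unfolding inverses by (auto simp: L_def)
    have ends: "f (int k)" "f (1 - int k)"
      using l f(2)[of "int k"] f(2)[of "1 - int k"] by fastforce+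
    have x: "foldl (\<otimes>) w hs \<in> carrier L"
      using w(1) hs moves by (intro L.foldl_mult_closed) auto
    \<comment> \<open>The step back writes lamp \<open>1 - length hs\<close>, which differs from the
      end lamp \<open>1 - int k\<close> because \<open>length hs < k\<close>.\<close>
    then obtain b where "state_of (foldl (\<otimes>) w hs \<otimes> g)
        = (f(- int (length hs) + 1 := b), - int (length hs) + 1)"
      using gen_step f(1) g by blast
    then have "len (foldl (\<otimes>) w hs \<otimes> g) = 4 * int k - \<bar>- int (length hs) + 1\<bar>"
    proof (rule len[rotated])
      show "foldl (\<otimes>) w hs \<otimes> g \<in> carrier L"
        using x g moves by blast
      show "1 - int k \<le> i \<and> i \<le> int k" if "(f(- int (length hs) + 1 := b)) i \<noteq> ?f i" for i
        using that f(2)[of i] l by (auto split: if_splits)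
    qed (use l ends in auto)
    then show ?thesis
      using l len_w by simp
  qed
  have one: "len (w \<otimes> g) = len w - 1 \<and> len (w \<otimes> inv g) = len w - 1" if g: "g \<in> {t, t \<otimes> a}" for g
  proof -
    have "m_inv L ` {t, t \<otimes> a} = {inv t, a \<otimes> inv t}"
      unfolding gens inverses unfolding L_def by (rule m_inv_lamp_gens)
    then have "inv g \<in> {inv t, a \<otimes> inv t}"
      using imageI[OF g, of "m_inv L"] by argo
    \<comment> \<open>Condition (1) is the one-letter case of the two monotone path
      computations.\<close>
    then show ?thesis
      using pos[of "[g]"] neg[of "[inv g]"] g assms(5) by simp
  qed
  show ?thesis
  proof (rule bexI[OF _ w(1)], intro conjI ballI allI impI; (elim conjE)?)
    fix g assume "g \<in> {t, t \<otimes> a}"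
    from one[OF this] show "len (w \<otimes> g) = len w - 1" and "len (w \<otimes> inv g) = len w - 1"
      by simp_all
  next
    fix l gs assume "l \<in> {1..k}" "length gs = l" "set gs \<subseteq> {t, t \<otimes> a}"
    then show "len (foldl (\<otimes>) w gs) = len w - int l"
      using pos[of gs] by simp
  next
    fix l gs h assume "l \<in> {1..k - 1}" "h \<in> {inv t, a \<otimes> inv t}"
      "length gs = l" "set gs \<subseteq> {t, t \<otimes> a}"
    then show "len (foldl (\<otimes>) w gs \<otimes> h) = len w - int l + 1"
      using pos_neg[of gs h] by simp
  next
    fix l hs assume "l \<in> {1..k}" "length hs = l" "set hs \<subseteq> {inv t, a \<otimes> inv t}"
    then show "len (foldl (\<otimes>) w hs) = len w - int l"
      using neg[of hs] by simp
  next
    fix l hs g assume "l \<in> {1..k - 1}" "g \<in> {t, t \<otimes> a}"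
      "length hs = l" "set hs \<subseteq> {inv t, a \<otimes> inv t}"
    then show "len (foldl (\<otimes>) w hs \<otimes> g) = len w - int l + 1"
      using neg_pos[of hs g] by simp
  qed
qed

end
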